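(* Let $S\subset\mathbb{R}^d$ be a nonempty compact set, let $W=\{W(s)\}_{s\in S}$ be a stochastic process with values in $C^+(S)$ and let $\omega_0>0$ be a constant. The following three statements are equivalent. 1. (Peaks-over-threshold) (a) $E\left(W(s)/\sup_{u\in S}W(u)\right)>0$ for all $s\in S$; (b) $P\left(\sup_{s\in S}W(s)/\omega_0>x\right)=x^{-1}$ for all $x>1$; (c) $$P\left(\frac{\omega_0W}{\sup_{s\in S}W(s)}\in B\ \Big|\ \sup_{s\in S}W(s)>r\right)=P\left(\frac{\omega_0W}{\sup_{s\in S}W(s)}\in B\right)$$ for all $r>\omega_0$ and all $B\in\mathcal{B}(\bar C^+_{\omega_0}(S))$. 2. (Random functions) (a) $P\left(\sup_{s\in S}W(s)>\omega_0\right)=1$; (b) $E\left(W(s)/\sup_{u\in S}W(u)\right)>0$ for all $s\in S$; (c) $P(W\in rA)=r^{-1}P(W\in A)$ for all $r>1$ and all $A\in\mathcal{B}(C^+_{\omega_0}(S))$. 3. (Constructive approach) $W(s)=YV(s)$ for all $s\in S$, for some random variable $Y$ and some $V=\{V(s)\}_{s\in S}$ satisfying: (a) $V$ is a stochastic process with values in $C^+(S)$ satisfying $\sup_{s\in S}V(s)=\omega_0$ almost surely, and $EV(s)>0$ for all $s\in S$; (b) $Y$ is a standard Pareto random variable, i.e. $P(Y\le y)=1-1/y$ for $y>1$; (c) $Y$ and $V$ are independent.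
   Context: $C(S)$ is the space of continuous real functions on $S$ with the supremum norm, and $C^+(S)=\{f\in C(S): f\ge 0\}$. Further $$C^+_{\omega_0}(S)=\{f\in C^+(S):\sup_{s\in S}f(s)\ge\omega_0\},\qquad \bar C^+_{\omega_0}(S)=\{f\in C^+(S):\sup_{s\in S}f(s)=\omega_0\}.$$ $\mathcal{B}(\cdot)$ denotes the class of Borel subsets of a metric space. For a set $A$ of functions and $r>0$, $rA=\{rf: f\in A\}$. Operations on functions are pointwise; e.g. $\omega_0W/\sup_{s\in S}W(s)$ is the random function $u\mapsto\omega_0W(u)/\sup_{s\in S}W(s)$. Quotients by $\sup_{s\in S}W(s)$ are set to $0$ where this supremum is $0$ (under each of the three statements this happens with probability zero). *)

theory Defs
  imports "HOL-Probability.Probability"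
begin

text \<open>
  C(S) is the library's metric space of bounded continuous functions on S with the supremum
  distance; boundedness is automatic for compact S. Its elements are extensional, i.e. equal to
  \<open>undefined\<close> off S, so they correspond exactly to the functions on S.
\<close>

definition C_space :: "'a::topological_space set \<Rightarrow> ('a \<Rightarrow> real) metric" where
  "C_space S = cfunspace (top_of_set S) euclidean_metric"

definition C_plus :: "'a::topological_space set \<Rightarrow> ('a \<Rightarrow> real) set" where
  "C_plus S = {f \<in> mspace (C_space S). \<forall>s\<in>S. 0 \<le> f s}"

definition C_plus_ge :: "real \<Rightarrow> 'a::topological_space set \<Rightarrow> ('a \<Rightarrow> real) set" where
  "C_plus_ge \<omega>\<^sub>0 S = {f \<in> C_plus S. (SUP s\<in>S. f s) \<ge> \<omega>\<^sub>0}"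

definition C_plus_eq :: "real \<Rightarrow> 'a::topological_space set \<Rightarrow> ('a \<Rightarrow> real) set" where
  "C_plus_eq \<omega>\<^sub>0 S = {f \<in> C_plus S. (SUP s\<in>S. f s) = \<omega>\<^sub>0}"

definition borel_subsets :: "'b metric \<Rightarrow> 'b set set" where
  "borel_subsets m = sigma_sets (mspace m) {U. openin (mtopology_of m) U}"

definition scale_fun :: "'a set \<Rightarrow> real \<Rightarrow> ('a \<Rightarrow> real) \<Rightarrow> 'a \<Rightarrow> real" where
  "scale_fun S r f = (\<lambda>s\<in>S. r * f s)"

definition scale_set :: "'a set \<Rightarrow> real \<Rightarrow> ('a \<Rightarrow> real) set \<Rightarrow> ('a \<Rightarrow> real) set" where
  "scale_set S r A = scale_fun S r ` A"

text \<open>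
  A stochastic process with values in \<open>C_plus S\<close>: a family of random variables indexed by S, all
  of whose sample paths lie in \<open>C_plus S\<close>. The path belonging to the outcome \<open>x\<close> is \<open>W x\<close>.
\<close>

definition C_plus_process ::
    "'w measure \<Rightarrow> 'a::topological_space set \<Rightarrow> ('w \<Rightarrow> 'a \<Rightarrow> real) \<Rightarrow> bool" where
  "C_plus_process M S W \<longleftrightarrow>
     (\<forall>s\<in>S. (\<lambda>x. W x s) \<in> borel_measurable M) \<and> (\<forall>x\<in>space M. W x \<in> C_plus S)"

text \<open>Where the supremum is 0, the quotients below are 0, since \<open>a / 0 = 0\<close>.\<close>

definition normalized_path :: "real \<Rightarrow> 'a set \<Rightarrow> ('a \<Rightarrow> real) \<Rightarrow> 'a \<Rightarrow> real" where
  "normalized_path \<omega>\<^sub>0 S f = (\<lambda>u\<in>S. \<omega>\<^sub>0 * f u / (SUP s\<in>S. f s))"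

definition peaks_over_threshold ::
    "'w measure \<Rightarrow> real \<Rightarrow> 'a::topological_space set \<Rightarrow> ('w \<Rightarrow> 'a \<Rightarrow> real) \<Rightarrow> bool" where
  "peaks_over_threshold M \<omega>\<^sub>0 S W \<longleftrightarrow>
     (\<forall>s\<in>S. integral\<^sup>L M (\<lambda>x. W x s / (SUP u\<in>S. W x u)) > 0) \<and>
     (\<forall>t>1. \<P>(x in M. (SUP s\<in>S. W x s) / \<omega>\<^sub>0 > t) = 1 / t) \<and>
     (\<forall>r>\<omega>\<^sub>0. \<forall>B \<in> borel_subsets (submetric (C_space S) (C_plus_eq \<omega>\<^sub>0 S)).
        \<P>(x in M. normalized_path \<omega>\<^sub>0 S (W x) \<in> B \<bar> (SUP s\<in>S. W x s) > r)
        = \<P>(x in M. normalized_path \<omega>\<^sub>0 S (W x) \<in> B))"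

definition pareto_random_function ::
    "'w measure \<Rightarrow> real \<Rightarrow> 'a::topological_space set \<Rightarrow> ('w \<Rightarrow> 'a \<Rightarrow> real) \<Rightarrow> bool" where
  "pareto_random_function M \<omega>\<^sub>0 S W \<longleftrightarrow>
     \<P>(x in M. (SUP s\<in>S. W x s) > \<omega>\<^sub>0) = 1 \<and>
     (\<forall>s\<in>S. integral\<^sup>L M (\<lambda>x. W x s / (SUP u\<in>S. W x u)) > 0) \<and>
     (\<forall>r>1. \<forall>A \<in> borel_subsets (submetric (C_space S) (C_plus_ge \<omega>\<^sub>0 S)).
        \<P>(x in M. W x \<in> scale_set S r A) = 1 / r * \<P>(x in M. W x \<in> A))"

definition standard_pareto :: "'w measure \<Rightarrow> ('w \<Rightarrow> real) \<Rightarrow> bool" where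
  "standard_pareto M Y \<longleftrightarrow>
     Y \<in> borel_measurable M \<and> (\<forall>y>1. \<P>(x in M. Y x \<le> y) = 1 - 1 / y)"

text \<open>
  Independence of \<open>Y\<close> and the process \<open>V\<close> is independence of the sigma-algebras generated by \<open>Y\<close>
  and by the family \<open>(V(s))\<close> for \<open>s\<close> in \<open>S\<close>; the latter is induced by the product sigma-algebra.
  The library's \<open>indep_var\<close> requires values of one common type and so does not apply.
\<close>

definition independent_of_process ::
    "'w measure \<Rightarrow> 'a set \<Rightarrow> ('w \<Rightarrow> real) \<Rightarrow> ('w \<Rightarrow> 'a \<Rightarrow> real) \<Rightarrow> bool" where
  "independent_of_process M S Y V \<longleftrightarrow>
     prob_space.indep_set M
       (sets (vimage_algebra (space M) Y borel))
       (sets (vimage_algebra (space M) V (Pi\<^sub>M S (\<lambda>_. borel))))"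

definition constructive_representation ::
    "'w measure \<Rightarrow> real \<Rightarrow> 'a::topological_space set \<Rightarrow> ('w \<Rightarrow> 'a \<Rightarrow> real) \<Rightarrow> bool" where
  "constructive_representation M \<omega>\<^sub>0 S W \<longleftrightarrow>
     (\<exists>(Y :: 'w \<Rightarrow> real) (V :: 'w \<Rightarrow> 'a \<Rightarrow> real).
        (\<forall>x\<in>space M. \<forall>s\<in>S. W x s = Y x * V x s) \<and>
        C_plus_process M S V \<and>
        (AE x in M. (SUP s\<in>S. V x s) = \<omega>\<^sub>0) \<and>
        (\<forall>s\<in>S. integral\<^sup>L M (\<lambda>x. V x s) > 0) \<and>
        standard_pareto M Y \<and>
        independent_of_process M S Y V)"

end

theory Submission
  imports Defs
begin

text \<open>
  Write \<open>m(f)\<close> for the supremum of a path \<open>f\<close> over \<open>S\<close>. A path with positive supremum is the same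
  thing as the pair of its size \<open>m(f) / \<omega>\<^sub>0\<close> and its shape, the rescaled path \<open>\<omega>\<^sub>0 f / m(f)\<close> with
  supremum \<open>\<omega>\<^sub>0\<close>. All three statements say that the size of \<open>W\<close> is standard Pareto and independent
  of its shape, whose mean is positive at every point. They are shown to imply each other in a cycle.

  From peaks over threshold to the construction (\<open>peaks_imp_constructive\<close>), \<open>Y\<close> and \<open>V\<close> are the
  size and the shape of \<open>W\<close>. That conditioning on \<open>Y > t\<close> does not change the law of \<open>V\<close>, for every
  \<open>t > 1\<close>, means that \<open>V\<close> is independent of the events \<open>Y > t\<close>. Up to null sets these are stable
  under intersection and generate the sigma-algebra of \<open>Y\<close> (\<open>independent_of_process_from_tails\<close>).

  From the construction to homogeneity (\<open>constructive_imp_pareto_random_function\<close>), the reason is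
  that the Pareto law has no scale: given \<open>Y \<ge> r\<close>, the ratio \<open>Y / r\<close> is again standard Pareto, and
  by independence the pair \<open>(Y / r, V)\<close> then has the law of \<open>(Y, V)\<close>
  (\<open>standard_pareto_rescaled_pair\<close>). Since every member of \<open>A\<close> has supremum at least \<open>\<omega>\<^sub>0\<close>, the
  event \<open>W \<in> rA\<close> almost surely forces \<open>Y \<ge> r\<close>, so its probability is the factor \<open>1 / r\<close>, the
  probability of \<open>Y \<ge> r\<close>, times that of \<open>W \<in> A\<close>.

  From homogeneity to peaks over threshold (\<open>pareto_random_function_imp_peaks\<close>), homogeneity is
  applied to the sets of paths with \<open>m(f) > \<omega>\<^sub>0\<close> and shape in \<open>B\<close>. Dilation by \<open>r\<close> raises the
  threshold to \<open>r \<omega>\<^sub>0\<close> and leaves the shape alone.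

  The three statements speak of Borel sets of the supremum metric, whereas processes and their
  independence are formulated with the sigma-algebra generated by the evaluations. On \<open>C(S)\<close> the two
  agree because \<open>S\<close> is compact and metrizable (\<open>borel_subsets_C_space_eq_cylinder_traces\<close>). This
  makes every event above measurable and turns \<open>W \<in> A\<close> into an event about the pair \<open>(Y, V)\<close>.
\<close>

section \<open>Borel sets of C(S) and evaluations\<close>

lemma mspace_C_space:
  assumes "compact S"
  shows "mspace (C_space S) = {f. f \<in> extensional S \<and> continuous_on S f}"
  using compact_imp_bounded[OF compact_continuous_image[OF _ assms]]
  by (auto simp: C_space_def)

lemma mdist_C_space_le_iff:
  assumes "f \<in> mspace (C_space S)" "g \<in> mspace (C_space S)" "S \<noteq> {}"
  shows "mdist (C_space S) f g \<le> e \<longleftrightarrow> (\<forall>s\<in>S. \<bar>f s - g s\<bar> \<le> e)"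
  using assms cfunspace_mdist_le[of f "top_of_set S" euclidean_metric g e]
  by (simp add: C_space_def dist_real_def)

lemma openin_C_space_iff:
  assumes "S \<noteq> {}"
  shows "openin (mtopology_of (C_space S)) U \<longleftrightarrow>
    U \<subseteq> mspace (C_space S) \<and>
    (\<forall>f\<in>U. \<exists>e>0. \<forall>g\<in>mspace (C_space S). (\<forall>s\<in>S. \<bar>f s - g s\<bar> \<le> e) \<longrightarrow> g \<in> U)"
  using mdist_C_space_le_iff[OF _ _ assms]
  unfolding mtopology_of_def Metric_space.openin_mtopology_mcball[OF Metric_space_mspace_mdist]
    Metric_space.mcball_def[OF Metric_space_mspace_mdist] subset_iff
  by (simp, smt (verit, best))

text \<open>
  This replaces a condition at all points of \<open>S\<close> by countably many, which is what makes suprema and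
  uniform distances of continuous paths measurable.
\<close>

lemma le_on_dense_iff:
  fixes f :: "'a::metric_space \<Rightarrow> real"
  assumes "continuous_on S f" "D \<subseteq> S" "S \<subseteq> closure D"
  shows "(\<forall>s\<in>D. f s \<le> c) \<longleftrightarrow> (\<forall>s\<in>S. f s \<le> c)"
proof
  assume le: "\<forall>s\<in>D. f s \<le> c"
  show "\<forall>s\<in>S. f s \<le> c"
  proof
    fix s assume "s \<in> S"
    then obtain u where u: "\<And>n. u n \<in> D" "u \<longlonglongrightarrow> s"
      using assms(3) closure_sequential[of s D] by blast
    have "(\<lambda>n. f (u n)) \<longlonglongrightarrow> f s"
      using assms(2) u(1)
      by (intro continuous_on_tendsto_compose[OF assms(1) u(2) \<open>s \<in> S\<close>] always_eventually) auto
    then show "f s \<le> c"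
      using u(1) le by (intro LIMSEQ_le_const2[of _ "f s" c]) auto
  qed
qed (use assms(2) in auto)

lemma sets_Collect_le_PiM:
  assumes "s \<in> S"
  shows "{g \<in> space (Pi\<^sub>M S (\<lambda>_. borel)). \<bar>g s - c\<bar> \<le> (e::real)} \<in> sets (Pi\<^sub>M S (\<lambda>_. borel))"
  using assms by measurable

lemma sets_Collect_diff_le_PiM:
  assumes "s \<in> S" "t \<in> S"
  shows "{g \<in> space (Pi\<^sub>M S (\<lambda>_. borel)). \<bar>g s - g t\<bar> \<le> (e::real)} \<in> sets (Pi\<^sub>M S (\<lambda>_. borel))"
  using assms by measurable

lemma mspace_C_space_subset_PiM:
  assumes "compact S"
  shows "mspace (C_space S) \<subseteq> space (Pi\<^sub>M S (\<lambda>_. borel))"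
  using assms by (auto simp: mspace_C_space space_PiM PiE_def)

text \<open>
  With a prescribed modulus of continuity, a continuous function is known up to a uniform error as
  soon as it is known approximately on a finite net. These cells encode such partial knowledge: \<open>n\<close>
  and \<open>k\<close> fix the modulus at one scale, and \<open>F\<close> lists points together with approximate values.
  For \<open>D\<close> countable and rational values there are only countably many cells, and membership in each
  is decided by evaluations at points of \<open>D\<close>. They play the part of a
  countable base of \<open>C(S)\<close> whose members are measurable for the evaluations.
\<close>

definition modulus_cell :: "'a::metric_space set \<Rightarrow> nat \<Rightarrow> nat \<Rightarrow> ('a \<times> real) set \<Rightarrow> ('a \<Rightarrow> real) set" where
  "modulus_cell D n k F = {g. (\<forall>s\<in>D. \<forall>t\<in>D. dist s t < 1 / Suc n \<longrightarrow> \<bar>g s - g t\<bar> \<le> 1 / Suc k) \<and>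
                      (\<forall>(d, q)\<in>F. \<bar>g d - q\<bar> \<le> 1 / Suc k)}"

lemma sets_modulus_cell:
  assumes "countable D" "D \<subseteq> S" "finite F" "F \<subseteq> D \<times> A"
  shows "modulus_cell D n k F \<inter> space (Pi\<^sub>M S (\<lambda>_. borel)) \<in> sets (Pi\<^sub>M S (\<lambda>_. borel))"
proof -
  have "modulus_cell D n k F \<inter> space (Pi\<^sub>M S (\<lambda>_. borel)) =
    {g \<in> space (Pi\<^sub>M S (\<lambda>_. borel)).
      (\<forall>s\<in>D. \<forall>t\<in>D. dist s t < 1 / Suc n \<longrightarrow> \<bar>g s - g t\<bar> \<le> 1 / Suc k) \<and>
      (\<forall>p\<in>F. \<bar>g (fst p) - snd p\<bar> \<le> 1 / Suc k)}"
    by (auto simp: modulus_cell_def split: prod.splits)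
  also have "\<dots> \<in> sets (Pi\<^sub>M S (\<lambda>_. borel))"
  proof -
    have "countable F" "\<And>s. s \<in> D \<Longrightarrow> s \<in> S" "\<And>p. p \<in> F \<Longrightarrow> fst p \<in> S"
      using assms countable_finite by auto
    then show ?thesis
      using assms(1) by (intro sets.sets_Collect_conj sets.sets_Collect_countable_All'
        sets.sets_Collect_imp sets_Collect_le_PiM sets_Collect_diff_le_PiM sets.sets_Collect_const)
  qed
  finally show ?thesis .
qed

text \<open>
  The triangle inequality passes from \<open>f s\<close> to \<open>g s\<close> through \<open>f d\<close>, the listed value \<open>q\<close> and
  \<open>g d\<close> for a nearby point \<open>d\<close> of the net, which accounts for four errors.
\<close>

lemma modulus_cell_diameter:
  fixes S :: "'a::metric_space set"
  assumes "f \<in> modulus_cell D n k F" "g \<in> modulus_cell D n k F" "continuous_on S f" "continuous_on S g"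
    and D: "D \<subseteq> S" "S \<subseteq> closure D" and "F \<subseteq> D \<times> A"
    and net: "\<And>s. s \<in> D \<Longrightarrow> \<exists>(d, q)\<in>F. dist s d < 1 / Suc n"
    and "s \<in> S"
  shows "\<bar>f s - g s\<bar> \<le> 4 / Suc k"
proof -
  have "\<bar>f s - g s\<bar> \<le> 4 / Suc k" if s: "s \<in> D" for s
  proof -
    obtain d q where d: "(d, q) \<in> F" "dist s d < 1 / Suc n"
      using net[OF s] by auto
    then have "d \<in> D" using assms by auto
    then have "\<bar>f s - f d\<bar> \<le> 1 / Suc k" "\<bar>g s - g d\<bar> \<le> 1 / Suc k"
      "\<bar>f d - q\<bar> \<le> 1 / Suc k" "\<bar>g d - q\<bar> \<le> 1 / Suc k"
      using assms(1,2) d s unfolding modulus_cell_def by blast+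
    moreover have "4 / Suc k = 1 / Suc k + 1 / Suc k + 1 / Suc k + 1 / real (Suc k)"
      by simp
    ultimately show ?thesis
      by linarith
  qed
  then have "\<forall>s\<in>D. \<bar>f s - g s\<bar> \<le> 4 / Suc k"
    by blast
  moreover have "continuous_on S (\<lambda>s. \<bar>f s - g s\<bar>)"
    using assms(3,4) by (intro continuous_intros)
  ultimately show ?thesis
    using le_on_dense_iff[OF _ D] \<open>s \<in> S\<close> by blast
qed

text \<open>
  Uniform continuity supplies the scale \<open>n\<close>, compactness a finite net at that scale inside \<open>D\<close>, and
  density of the rationals the listed values.
\<close>

lemma ex_modulus_cell:
  fixes S :: "'a::metric_space set"
  assumes "compact S" "continuous_on S f" and D: "D \<subseteq> S" "S \<subseteq> closure D"
  obtains n F where "finite F" "F \<subseteq> D \<times> \<rat>" "f \<in> modulus_cell D n k F"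
    "\<And>s. s \<in> D \<Longrightarrow> \<exists>(d, q)\<in>F. dist s d < 1 / Suc n"
proof -
  have "uniformly_continuous_on S f"
    using assms by (intro compact_uniformly_continuous)
  then obtain e where e: "e > 0" "\<And>s t. s \<in> S \<Longrightarrow> t \<in> S \<Longrightarrow> dist t s < e \<Longrightarrow> dist (f t) (f s) < 1 / Suc k"
    unfolding uniformly_continuous_on_def by (metis of_nat_0_less_iff zero_less_Suc zero_less_divide_1_iff)
  then obtain n where n: "1 / Suc n < e"
    using nat_approx_posE by metis
  have "S \<subseteq> (\<Union>d\<in>D. ball d (1 / Suc n))"
  proof
    fix s assume "s \<in> S"
    then have "s \<in> closure D" using D by auto
    then obtain d where "d \<in> D" "dist d s < 1 / Suc n"
      unfolding closure_approachable by (metis of_nat_0_less_iff zero_less_Suc zero_less_divide_1_iff)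
    then show "s \<in> (\<Union>d\<in>D. ball d (1 / Suc n))" by auto
  qed
  then obtain E where E: "E \<subseteq> D" "finite E" "S \<subseteq> (\<Union>d\<in>E. ball d (1 / Suc n))"
    using compactE_image[OF \<open>compact S\<close>, of D "\<lambda>d. ball d (1 / Suc n)"] by auto
  have "\<exists>q\<in>\<rat>. \<bar>f d - q\<bar> \<le> 1 / Suc k" for d
    using Rats_dense_in_real[of "f d - 1 / Suc k" "f d"] by force
  then obtain q where q: "\<And>d. q d \<in> \<rat>" "\<And>d. \<bar>f d - q d\<bar> \<le> 1 / Suc k"
    by metis
  define F where "F = (\<lambda>d. (d, q d)) ` E"
  show thesis
  proof
    show "finite F" "F \<subseteq> D \<times> \<rat>"
      using E q by (auto simp: F_def)
    have "\<bar>f s - f t\<bar> \<le> 1 / Suc k" if "s \<in> D" "t \<in> D" "dist s t < 1 / Suc n" for s t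
      using e(2)[of t s] that D(1) n unfolding dist_real_def
      by (meson in_mono less_eq_real_def less_trans)
    then show "f \<in> modulus_cell D n k F"
      using q by (auto simp: modulus_cell_def F_def)
    show "\<exists>(d, q)\<in>F. dist s d < 1 / Suc n" if "s \<in> D" for s
    proof -
      have "s \<in> (\<Union>d\<in>E. ball d (1 / Suc n))" using that E(3) D(1) by blast
      then show ?thesis by (auto simp: F_def dist_commute)
    qed
  qed
qed

text \<open>
  Within \<open>C(S)\<close>, an open set is the union of the countably many cells that it contains.
\<close>

lemma open_eq_cylinder_trace:
  fixes S :: "'a::{metric_space, second_countable_topology} set"
  assumes "compact S" "S \<noteq> {}" "openin (mtopology_of (C_space S)) U"
  obtains E where "E \<in> sets (Pi\<^sub>M S (\<lambda>_. borel))" "U = E \<inter> mspace (C_space S)"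
proof -
  obtain D where D: "countable D" "D \<subseteq> S" "S \<subseteq> closure D"
    using separable[of S] by blast
  let ?P = "Pi\<^sub>M S (\<lambda>_. borel) :: ('a \<Rightarrow> real) measure" and ?C = "mspace (C_space S)"
  define I where "I = {(n, k, F). finite F \<and> F \<subseteq> D \<times> \<rat> \<and> modulus_cell D n k F \<inter> ?C \<subseteq> U}"
  define E where "E = (\<Union>(n, k, F)\<in>I. modulus_cell D n k F \<inter> space ?P)"
  show thesis
  proof
    have "countable (UNIV \<times> UNIV \<times> {F. finite F \<and> F \<subseteq> D \<times> (\<rat>::real set)} :: (nat \<times> nat \<times> _) set)"
      by (intro countable_SIGMA countable_Collect_finite_subset D countable_rat) auto
    then have "countable I"
      by (rule countable_subset[rotated]) (auto simp: I_def)
    then show "E \<in> sets ?P"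
      unfolding E_def using D
      by (intro sets.countable_UN'') (auto simp: I_def intro: sets_modulus_cell)
    show "U = E \<inter> ?C"
    proof (intro equalityI subsetI)
      fix f assume "f \<in> U"
      then obtain e where e: "e > 0" "\<And>g. g \<in> ?C \<Longrightarrow> (\<And>s. s\<in>S \<Longrightarrow> \<bar>f s - g s\<bar> \<le> e) \<Longrightarrow> g \<in> U"
        and f: "f \<in> ?C"
        using assms(3) unfolding openin_C_space_iff[OF assms(2)] by blast
      obtain k where k: "1 / Suc k < e / 4"
        using nat_approx_posE[of "e/4"] e(1) by auto
      have cont: "continuous_on S g" if "g \<in> ?C" for g
        using that by (simp add: mspace_C_space assms)
      obtain n F where F: "finite F" "F \<subseteq> D \<times> \<rat>" "f \<in> modulus_cell D n k F"
          "\<And>s. s \<in> D \<Longrightarrow> \<exists>(d, q)\<in>F. dist s d < 1 / Suc n"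
        using ex_modulus_cell[OF assms(1) cont[OF f] D(2,3)] by metis
      have "g \<in> U" if "g \<in> modulus_cell D n k F" "g \<in> ?C" for g
      proof (rule e(2)[OF that(2)])
        fix s assume "s \<in> S"
        then have "\<bar>f s - g s\<bar> \<le> 4 / Suc k"
          using that F D cont f by (intro modulus_cell_diameter) auto
        moreover have "4 / Suc k = 4 * (1 / real (Suc k))" by simp
        ultimately show "\<bar>f s - g s\<bar> \<le> e" using k by linarith
      qed
      then have "(n, k, F) \<in> I" using F by (auto simp: I_def)
      then show "f \<in> E \<inter> ?C"
        using f F(3) mspace_C_space_subset_PiM[OF assms(1)] unfolding E_def by blast
    qed (auto simp: E_def I_def)
  qed
qed

lemma borel_subsets_submetric:
  "borel_subsets (submetric m X) =
    sigma_sets (X \<inter> mspace m) {U \<inter> X |U. openin (mtopology_of m) U}"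
  unfolding borel_subsets_def mtopology_of_submetric openin_subtopology
  by (auto simp: Int_commute Setcompr_eq_image image_iff intro!: arg_cong2[of _ _ _ _ sigma_sets])

text \<open>
  One inclusion is the preceding lemma; the other holds because evaluation at a point is continuous
  for the supremum metric. The set \<open>C(S)\<close> itself is in general not measurable in the product, since
  continuity involves uncountably many coordinates. Hence \<open>restrict_space\<close>, which forms the trace
  on an arbitrary subset.
\<close>

lemma borel_subsets_C_space_eq_cylinder_traces:
  fixes S :: "'a::{metric_space, second_countable_topology} set"
  assumes "compact S" "S \<noteq> {}" "X \<subseteq> mspace (C_space S)"
  shows "borel_subsets (submetric (C_space S) X) = sets (restrict_space (Pi\<^sub>M S (\<lambda>_. borel)) X)"
proof
  let ?P = "Pi\<^sub>M S (\<lambda>_. borel) :: ('a \<Rightarrow> real) measure" and ?C = "mspace (C_space S)"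
  let ?O = "{U \<inter> X |U. openin (mtopology_of (C_space S)) U}"
  have X: "X \<subseteq> space ?P" "X \<inter> ?C = X"
    using assms mspace_C_space_subset_PiM[OF assms(1)] by auto
  show "borel_subsets (submetric (C_space S) X) \<subseteq> sets (restrict_space ?P X)"
    unfolding borel_subsets_submetric X
  proof (rule sets.sigma_sets_subset')
    show "?O \<subseteq> sets (restrict_space ?P X)"
    proof
      fix A assume "A \<in> ?O"
      then obtain U where U: "A = U \<inter> X" "openin (mtopology_of (C_space S)) U" by auto
      obtain E where "E \<in> sets ?P" "U = E \<inter> ?C"
        using open_eq_cylinder_trace[OF assms(1,2) U(2)] by blast
      then show "A \<in> sets (restrict_space ?P X)"
        using U(1) assms(3) unfolding sets_restrict_space by auto
    qed
    show "X \<in> sets (restrict_space ?P X)"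
      using X(1) sets.top[of ?P] unfolding sets_restrict_space by blast
  qed
  let ?N = "sigma X ?O"
  have O: "?O \<subseteq> Pow X" by auto
  have id: "(\<lambda>f s. f s) \<in> measurable ?N ?P"
  proof (rule measurable_PiM_single')
    show "(\<lambda>f s. f s) \<in> space ?N \<rightarrow> (\<Pi>\<^sub>E s\<in>S. space (borel :: real measure))"
      using X(1) by (auto simp: space_PiM space_measure_of_conv)
    fix s assume s: "s \<in> S"
    show "(\<lambda>f. f s) \<in> borel_measurable ?N"
    proof (rule borel_measurableI_greater)
      fix a
      have "openin (mtopology_of (C_space S)) {f \<in> ?C. f s > a}"
        unfolding openin_C_space_iff[OF assms(2)]
      proof (intro conjI ballI)
        fix f assume f: "f \<in> {f \<in> ?C. f s > a}"
        show "\<exists>e>0. \<forall>g\<in>?C. (\<forall>s\<in>S. \<bar>f s - g s\<bar> \<le> e) \<longrightarrow> g \<in> {f \<in> ?C. f s > a}"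
          using f s by (intro exI[of _ "(f s - a) / 2"])
            (auto simp: field_simps abs_if split: if_splits dest!: bspec[of _ _ s])
      qed auto
      then have "{f \<in> ?C. f s > a} \<inter> X \<in> sets ?N"
        unfolding sets_measure_of[OF O] by blast
      moreover have "{f \<in> ?C. f s > a} \<inter> X = {f \<in> space ?N. a < f s}"
        using X by (auto simp: space_measure_of_conv)
      ultimately show "{f \<in> space ?N. a < f s} \<in> sets ?N" by simp
    qed
  qed
  have "E \<inter> X \<in> sets ?N" if "E \<in> sets ?P" for E
    using measurable_sets[OF id that] by (simp add: space_measure_of_conv vimage_def)
  then show "sets (restrict_space ?P X) \<subseteq> borel_subsets (submetric (C_space S) X)"
    unfolding borel_subsets_submetric X sets_restrict_space
    using sets_measure_of[OF O] by (auto simp: Int_commute)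
qed

section \<open>The measurable space of nonnegative paths\<close>

lemma C_plus_iff:
  assumes "compact S"
  shows "f \<in> C_plus S \<longleftrightarrow> f \<in> extensional S \<and> continuous_on S f \<and> (\<forall>s\<in>S. 0 \<le> f s)"
  using assms by (auto simp: C_plus_def mspace_C_space)

lemma C_plus_subset_space:
  assumes "compact S"
  shows "C_plus S \<subseteq> space (Pi\<^sub>M S (\<lambda>_. borel))"
  using mspace_C_space_subset_PiM[OF assms] by (auto simp: C_plus_def)

lemma SUP_attained:
  fixes f :: "'a::topological_space \<Rightarrow> real"
  assumes "compact S" "S \<noteq> {}" "continuous_on S f"
  obtains s where "s \<in> S" "(SUP t\<in>S. f t) = f s" "\<And>t. t \<in> S \<Longrightarrow> f t \<le> f s"
proof -
  obtain s where s: "s \<in> S" "\<And>t. t \<in> S \<Longrightarrow> f t \<le> f s"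
    using continuous_attains_sup[OF assms] by blast
  moreover have "(SUP t\<in>S. f t) = f s"
    using s by (intro cSup_eq_maximum) auto
  ultimately show thesis using that by blast
qed

lemma SUP_mult_left_nonneg:
  fixes f :: "'a::topological_space \<Rightarrow> real"
  assumes "compact S" "S \<noteq> {}" "continuous_on S f" "0 \<le> c"
  shows "(SUP s\<in>S. c * f s) = c * (SUP s\<in>S. f s)"
proof -
  obtain s where s: "s \<in> S" "(SUP t\<in>S. f t) = f s" "\<And>t. t \<in> S \<Longrightarrow> f t \<le> f s"
    using SUP_attained[OF assms(1-3)] by blast
  have "(SUP t\<in>S. c * f t) = c * f s"
    using s assms(4) by (intro cSup_eq_maximum) (auto intro: mult_left_mono)
  then show ?thesis using s by simp
qed

abbreviation path_space :: "'a::topological_space set \<Rightarrow> ('a \<Rightarrow> real) measure" where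
  "path_space S \<equiv> restrict_space (Pi\<^sub>M S (\<lambda>_. borel)) (C_plus S)"

lemma space_path_space:
  "compact S \<Longrightarrow> space (path_space S) = C_plus S"
  using C_plus_subset_space[of S] by (auto simp: space_restrict_space)

lemma measurable_into_path_space:
  assumes S: "compact S" and "\<And>s. s \<in> S \<Longrightarrow> (\<lambda>x. F x s) \<in> borel_measurable N"
    and C: "\<And>x. x \<in> space N \<Longrightarrow> F x \<in> C_plus S"
  shows "F \<in> N \<rightarrow>\<^sub>M path_space S"
proof (rule measurable_restrict_space2)
  show "F \<in> N \<rightarrow>\<^sub>M Pi\<^sub>M S (\<lambda>_. borel)"
  proof (rule measurable_PiM_single'[of S "\<lambda>s x. F x s" N "\<lambda>_. borel"])
    show "(\<lambda>x s. F x s) \<in> space N \<rightarrow> (\<Pi>\<^sub>E s\<in>S. space borel)"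
      using C C_plus_subset_space[OF S] by (simp add: space_PiM Pi_iff subset_iff)
  qed (rule assms(2))
qed (use C in auto)

text \<open>
  A process with continuous paths is a single random element of path space. This allows measurable
  maps on paths to be composed with it.
\<close>

lemma C_plus_process_iff_measurable:
  assumes "compact S"
  shows "C_plus_process M S W \<longleftrightarrow> W \<in> M \<rightarrow>\<^sub>M path_space S"
proof
  assume W: "W \<in> M \<rightarrow>\<^sub>M path_space S"
  have "(\<lambda>x. W x s) \<in> borel_measurable M" if "s \<in> S" for s
    using measurable_compose[OF W measurable_restrict_space1[OF measurable_component_singleton[OF that]]] .
  then show "C_plus_process M S W"
    using measurable_space[OF W] by (auto simp: C_plus_process_def space_path_space[OF assms])
qed (auto simp: C_plus_process_def intro!: measurable_into_path_space assms)

lemma measurable_path_eval: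
  assumes "s \<in> S"
  shows "(\<lambda>f. f s) \<in> borel_measurable (path_space S)"
  by (intro measurable_restrict_space1 measurable_component_singleton assms)

lemma measurable_path_SUP:
  fixes S :: "'a::{metric_space, second_countable_topology} set"
  assumes "compact S" "S \<noteq> {}"
  shows "(\<lambda>f. SUP s\<in>S. f s) \<in> borel_measurable (path_space S)"
proof (rule borel_measurableI_le)
  fix c
  obtain D where D: "countable D" "D \<subseteq> S" "S \<subseteq> closure D"
    using separable[of S] by blast
  have "(SUP s\<in>S. f s) \<le> c \<longleftrightarrow> (\<forall>s\<in>D. f s \<le> c)" if "f \<in> C_plus S" for f
  proof -
    have f: "continuous_on S f" using that assms(1) by (simp add: C_plus_iff)
    show ?thesis
      unfolding le_on_dense_iff[OF f D(2,3)]
      using SUP_attained[OF assms f] by (metis order_trans)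
  qed
  then have "{f \<in> space (path_space S). (SUP s\<in>S. f s) \<le> c} =
      {f \<in> space (path_space S). \<forall>s\<in>D. f s \<le> c}"
    by (auto simp: space_path_space[OF assms(1)])
  also have "\<dots> \<in> sets (path_space S)"
    using D measurable_path_eval[of _ S]
    by (intro sets.sets_Collect_countable_All' borel_measurable_le) auto
  finally show "{f \<in> space (path_space S). (SUP s\<in>S. f s) \<le> c} \<in> sets (path_space S)" .
qed

lemma normalized_path_in_C_plus:
  assumes "compact S" "S \<noteq> {}" "0 \<le> \<omega>" "f \<in> C_plus S"
  shows "normalized_path \<omega> S f \<in> C_plus S"
proof -
  have f: "continuous_on S f" "\<And>s. s \<in> S \<Longrightarrow> 0 \<le> f s"
    using assms by (auto simp: C_plus_iff)
  have "0 \<le> (SUP s\<in>S. f s)"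
    using SUP_attained[OF assms(1,2) f(1)] f(2) by metis
  moreover have "continuous_on S (\<lambda>u. \<omega> * f u / (SUP s\<in>S. f s))"
    using f(1) unfolding divide_inverse by (intro continuous_intros)
  ultimately show ?thesis
    using f assms unfolding C_plus_iff[OF assms(1)] normalized_path_def
    by (auto cong: continuous_on_cong)
qed

lemma SUP_normalized_path:
  assumes "compact S" "S \<noteq> {}" "0 \<le> \<omega>" "f \<in> C_plus S" "(SUP s\<in>S. f s) > 0"
  shows "(SUP s\<in>S. normalized_path \<omega> S f s) = \<omega>"
proof -
  have "(SUP s\<in>S. normalized_path \<omega> S f s) = (SUP s\<in>S. (\<omega> / (SUP s\<in>S. f s)) * f s)"
    by (intro SUP_cong) (auto simp: normalized_path_def)
  also have "\<dots> = \<omega> / (SUP s\<in>S. f s) * (SUP s\<in>S. f s)"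
    using assms by (intro SUP_mult_left_nonneg) (auto simp: C_plus_iff)
  finally show ?thesis using assms(5) by simp
qed

lemma measurable_normalized_path:
  fixes S :: "'a::{metric_space, second_countable_topology} set"
  assumes "compact S" "S \<noteq> {}" "0 \<le> \<omega>"
  shows "normalized_path \<omega> S \<in> path_space S \<rightarrow>\<^sub>M path_space S"
  using assms measurable_path_eval[of _ S] measurable_path_SUP[OF assms(1,2)]
  by (intro measurable_into_path_space)
    (auto simp: normalized_path_def[abs_def] space_path_space normalized_path_in_C_plus[unfolded normalized_path_def])

lemma scale_fun_in_C_plus:
  assumes "compact S" "0 \<le> r" "f \<in> C_plus S"
  shows "scale_fun S r f \<in> C_plus S"
  using assms by (auto simp: C_plus_iff scale_fun_def intro!: continuous_intros cong: continuous_on_cong)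

lemma SUP_scale_fun:
  assumes "compact S" "S \<noteq> {}" "0 \<le> r" "f \<in> C_plus S"
  shows "(SUP s\<in>S. scale_fun S r f s) = r * (SUP s\<in>S. f s)"
  using SUP_mult_left_nonneg[of S f r] assms by (simp add: scale_fun_def C_plus_iff)

lemma measurable_scale_fun:
  assumes "compact S" "0 \<le> r"
  shows "scale_fun S r \<in> path_space S \<rightarrow>\<^sub>M path_space S"
  using assms measurable_path_eval[of _ S]
  by (intro measurable_into_path_space)
    (auto simp: scale_fun_def[abs_def] space_path_space scale_fun_in_C_plus[unfolded scale_fun_def])

text \<open>
  Events \<open>W \<in> rA\<close> are turned into preimages under the measurable map \<open>scale_fun\<close>. Extensionality
  matters because scaling resets the values outside \<open>S\<close>, so it is injective only on functions that
  agree there.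
\<close>

lemma in_scale_set_iff:
  assumes "r > 0" "f \<in> extensional S" "A \<subseteq> extensional S"
  shows "f \<in> scale_set S r A \<longleftrightarrow> scale_fun S (1 / r) f \<in> A"
proof -
  have inv: "scale_fun S (1 / c) (scale_fun S c g) = g" if "g \<in> extensional S" "c > 0" for g and c :: real
    using that by (auto simp: scale_fun_def fun_eq_iff extensional_def)
  show ?thesis
  proof
    assume "f \<in> scale_set S r A"
    then obtain g where "g \<in> A" "f = scale_fun S r g"
      by (auto simp: scale_set_def)
    then show "scale_fun S (1 / r) f \<in> A"
      using inv[of g r] assms by auto
  next
    assume "scale_fun S (1 / r) f \<in> A"
    then show "f \<in> scale_set S r A"
      using inv[of f "1 / r"] assms unfolding scale_set_def by (intro image_eqI) auto
  qed
qed

lemma normalized_path_scale_fun: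
  assumes "compact S" "S \<noteq> {}" "0 < r" "f \<in> C_plus S"
  shows "normalized_path \<omega> S (scale_fun S r f) = normalized_path \<omega> S f"
proof -
  have "(SUP s\<in>S. scale_fun S r f s) = r * (SUP s\<in>S. f s)"
    using SUP_scale_fun[of S r f] assms by simp
  then show ?thesis
    using assms(3) unfolding normalized_path_def
    by (intro restrict_ext) (simp add: scale_fun_def)
qed

lemma normalized_path_in_C_plus_eq:
  assumes "compact S" "S \<noteq> {}" "0 \<le> \<omega>" "f \<in> C_plus S" "(SUP s\<in>S. f s) > 0"
  shows "normalized_path \<omega> S f \<in> C_plus_eq \<omega> S"
  using SUP_normalized_path[OF assms] normalized_path_in_C_plus[OF assms(1-4)]
  by (simp add: C_plus_eq_def)

lemma sets_C_plus_ge_C_plus_eq: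
  fixes S :: "'a::{metric_space, second_countable_topology} set"
  assumes "compact S" "S \<noteq> {}"
  shows "C_plus_ge \<omega> S \<in> sets (path_space S)" and "C_plus_eq \<omega> S \<in> sets (path_space S)"
proof -
  note [measurable] = measurable_path_SUP[OF assms]
  have "C_plus_ge \<omega> S = {f \<in> space (path_space S). (SUP s\<in>S. f s) \<ge> \<omega>}"
    "C_plus_eq \<omega> S = {f \<in> space (path_space S). (SUP s\<in>S. f s) = \<omega>}"
    by (simp_all add: C_plus_ge_def C_plus_eq_def space_path_space assms(1))
  then show "C_plus_ge \<omega> S \<in> sets (path_space S)" and "C_plus_eq \<omega> S \<in> sets (path_space S)"
    by simp_all
qed

text \<open>
  This is the form in which the identification of Borel sets with evaluation-measurable sets is used.
  It applies to both constraint sets of the theorem because the supremum is a measurable function on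
  path space.
\<close>

lemma borel_subsets_iff_sets_path_space:
  fixes S :: "'a::{metric_space, second_countable_topology} set"
  assumes "compact S" "S \<noteq> {}" "X \<in> sets (path_space S)"
  shows "A \<in> borel_subsets (submetric (C_space S) X) \<longleftrightarrow> A \<in> sets (path_space S) \<and> A \<subseteq> X"
proof -
  have X: "X \<subseteq> C_plus S"
    using sets.sets_into_space[OF assms(3)] space_path_space[OF assms(1)] by blast
  then have "X \<subseteq> mspace (C_space S)"
    by (auto simp: C_plus_def)
  moreover have "sets (restrict_space (path_space S) X) = sets (restrict_space (Pi\<^sub>M S (\<lambda>_. borel)) X)"
    unfolding sets_restrict_restrict_space using X by (simp add: Int_absorb1)
  moreover have "X \<inter> space (path_space S) = X"
    using sets.sets_into_space[OF assms(3)] by blast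
  ultimately show ?thesis
    using borel_subsets_C_space_eq_cylinder_traces[OF assms(1,2), of X] assms(3)
      sets_restrict_space_iff[of X "path_space S" A] by auto
qed

section \<open>The standard Pareto law and its scale invariance\<close>

lemma vimage_Int_eq_Collect: "f -` A \<inter> B = {x \<in> B. f x \<in> A}"
  by auto

text \<open>
  The distribution function is prescribed only above 1. The limit from above at 1 shows that no mass
  lies in the half-line up to 1, and the limit from below at \<open>t\<close> that \<open>t\<close> is not an atom.
\<close>

lemma standard_pareto_tail:
  assumes "prob_space M" "standard_pareto M Y" "t \<ge> 1"
  shows "measure M {x \<in> space M. Y x > t} = 1 / t"
    and "measure M {x \<in> space M. Y x \<ge> t} = 1 / t"
proof -
  interpret prob_space M by fact
  have Y[measurable]: "Y \<in> borel_measurable M"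
    and cdf: "\<And>y. y > 1 \<Longrightarrow> prob {x \<in> space M. Y x \<le> y} = 1 - 1 / y"
    using assms by (auto simp: standard_pareto_def)
  have gt: "prob {x \<in> space M. Y x > y} = 1 / y" if "y > 1" for y
    using prob_neg[of "\<lambda>x. Y x \<le> y"] cdf[OF that] by (simp add: not_le)
  have gt1: "prob {x \<in> space M. Y x > 1} = 1"
  proof (rule ccontr)
    let ?q = "prob {x \<in> space M. Y x > 1}"
    have q: "1 / y \<le> ?q" if "y > 1" for y
      using that by (subst gt[OF that, symmetric]) (auto intro!: finite_measure_mono)
    assume "?q \<noteq> 1"
    then have "?q < 1" using prob_le_1[of "{x \<in> space M. Y x > 1}"] by linarith
    moreover have "?q > 0" using q[of 2] by simp
    \<comment> \<open>This point is so close to 1 that its tail \<open>1 / y\<close> exceeds \<open>?q\<close>.\<close>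
    ultimately obtain y where y: "1 < y" "y < 1 / ?q"
      using dense[of 1 "1 / ?q"] by auto
    with q[of y] \<open>?q > 0\<close> show False by (simp add: field_simps)
  qed
  show "prob {x \<in> space M. Y x > t} = 1 / t"
    using gt gt1 assms(3) by (cases "t = 1") auto
  moreover have "prob {x \<in> space M. Y x > t} \<le> prob {x \<in> space M. Y x \<ge> t}"
    by (intro finite_measure_mono) auto
  ultimately have lower: "1 / t \<le> prob {x \<in> space M. Y x \<ge> t}"
    by simp
  show "prob {x \<in> space M. Y x \<ge> t} = 1 / t"
  proof (rule ccontr)
    let ?q = "prob {x \<in> space M. Y x \<ge> t}"
    assume "?q \<noteq> 1 / t"
    with lower have q: "?q > 1 / t" by simp
    then have t: "t > 1" using prob_le_1[of "{x \<in> space M. Y x \<ge> t}"] assms(3)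
      by (cases "t = 1") (simp_all add: not_less[symmetric] del: prob_le_1)
    have q0: "?q > 0" using q assms(3) by (meson divide_pos_pos less_trans less_le_trans zero_less_one)
    then have "1 / ?q < t" using q t by (simp add: field_simps)
    \<comment> \<open>This point is so close to \<open>t\<close> that its tail \<open>1 / y\<close> is still below \<open>?q\<close>.\<close>
    then obtain y where y: "max 1 (1 / ?q) < y" "y < t"
      using dense[of "max 1 (1 / ?q)" t] t by auto
    have "?q \<le> prob {x \<in> space M. Y x > y}"
      using y by (intro finite_measure_mono) auto
    also have "\<dots> = 1 / y" using y gt by auto
    finally show False using y q0 by (simp add: field_simps)
  qed
qed

lemma standard_pareto_AE_gt_1:
  assumes "prob_space M" "standard_pareto M Y"
  shows "AE x in M. 1 < Y x"
proof -
  interpret prob_space M by fact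
  have [measurable]: "Y \<in> borel_measurable M"
    using assms by (simp add: standard_pareto_def)
  show ?thesis
    using standard_pareto_tail(1)[OF assms, of 1] prob_Collect_eq_1[of "\<lambda>x. 1 < Y x"] by simp
qed

text \<open>
  This is the memoryless property of the exponential variable \<open>ln Y\<close>, written multiplicatively.
  For \<open>a \<ge> 1\<close> the probabilities \<open>1 / (ra)\<close> of \<open>Y > ra\<close> and \<open>1 / r\<close> of \<open>Y \<ge> r\<close> have the
  quotient \<open>1 / a\<close>; for \<open>a < 1\<close> the half-line above \<open>a\<close> has full mass under both laws.
\<close>

lemma standard_pareto_rescaled:
  assumes "prob_space M" "standard_pareto M Y" "r \<ge> 1"
  shows "distr (uniform_measure M {x \<in> space M. r \<le> Y x}) borel (\<lambda>x. Y x / r) = distr M borel Y"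
    (is "distr ?U borel _ = _")
proof (rule measure_eqI_lessThan)
  interpret prob_space M by fact
  have Y[measurable]: "Y \<in> borel_measurable M"
    using assms by (simp add: standard_pareto_def)
  note tail = standard_pareto_tail[OF assms(1,2)]
  have pos: "emeasure M {x \<in> space M. r \<le> Y x} \<noteq> 0"
    using tail(2)[of r] assms(3) by (auto simp: emeasure_eq_measure)
  interpret U: prob_space ?U
    using pos by (intro prob_space_uniform_measure) (auto simp: emeasure_eq_measure)
  fix a :: real
  let ?m = "max 1 a"
  have "measure ?U {x \<in> space M. a < Y x / r} =
      measure M ({x \<in> space M. r \<le> Y x} \<inter> {x \<in> space M. a < Y x / r}) / (1 / r)"
    using tail(2)[of r] assms(3) pos
    by (subst measure_uniform_measure) (auto simp: emeasure_eq_measure)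
  also have "measure M ({x \<in> space M. r \<le> Y x} \<inter> {x \<in> space M. a < Y x / r}) = 1 / (r * ?m)"
  proof (cases "a < 1")
    case True
    then have "{x \<in> space M. r \<le> Y x} \<inter> {x \<in> space M. a < Y x / r} = {x \<in> space M. r \<le> Y x}"
      using assms(3) by (auto simp: field_simps intro: less_le_trans[of "a * r" "1 * r"])
    then show ?thesis using tail(2)[of r] assms(3) True by simp
  next
    case False
    have "r \<le> r * a" using False assms(3) by simp
    moreover have "a < Y x / r \<longleftrightarrow> r * a < Y x" for x
      using assms(3) by (simp add: pos_less_divide_eq mult.commute)
    ultimately have "{x \<in> space M. r \<le> Y x} \<inter> {x \<in> space M. a < Y x / r} =
        {x \<in> space M. r * a < Y x}"
      by fastforce
    moreover have "1 * 1 \<le> r * a" using False assms(3) by (intro mult_mono) auto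
    ultimately show ?thesis using tail(1)[of "r * a"] False by simp
  qed
  also have "1 / (r * ?m) / (1 / r) = 1 / ?m" using assms(3) by simp
  also have "1 / ?m = measure M {x \<in> space M. a < Y x}"
  proof (cases "a < 1")
    case True
    then have "measure M {x \<in> space M. 1 < Y x} \<le> measure M {x \<in> space M. a < Y x}"
      by (intro finite_measure_mono) auto
    then show ?thesis using tail(1)[of 1] True prob_le_1[of "{x \<in> space M. a < Y x}"] by simp
  qed (use tail(1)[of a] in simp)
  finally have "measure ?U {x \<in> space M. a < Y x / r} = measure M {x \<in> space M. a < Y x}" .
  then show "emeasure (distr ?U borel (\<lambda>x. Y x / r)) {a <..} = emeasure (distr M borel Y) {a <..}"
    by (simp add: emeasure_distr emeasure_eq_measure U.emeasure_eq_measure vimage_Int_eq_Collect)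
  show "emeasure (distr ?U borel (\<lambda>x. Y x / r)) {a <..} < \<infinity>"
    by (simp add: emeasure_distr U.emeasure_eq_measure)
qed simp_all

text \<open>
  Conditioning on an event of \<open>Y\<close> changes neither the law of \<open>V\<close> nor its independence from \<open>Y\<close>, so
  only the first marginal has to be compared, which the preceding lemma does. Rectangles suffice.
\<close>

lemma standard_pareto_rescaled_pair:
  assumes "prob_space M" "standard_pareto M Y" "V \<in> M \<rightarrow>\<^sub>M N" "r \<ge> 1"
    and indep: "prob_space.indep_set M (sets (vimage_algebra (space M) Y borel))
      (sets (vimage_algebra (space M) V N))"
  shows "distr (uniform_measure M {x \<in> space M. r \<le> Y x}) (borel \<Otimes>\<^sub>M N) (\<lambda>x. (Y x / r, V x)) =
    distr M borel Y \<Otimes>\<^sub>M distr M N V"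
    (is "distr ?U _ _ = _")
proof (rule pair_measure_eqI[symmetric])
  interpret prob_space M by fact
  have Y[measurable]: "Y \<in> borel_measurable M"
    using assms by (simp add: standard_pareto_def)
  note V[measurable] = assms(3)
  have [simp]: "measure M {x \<in> space M. r \<le> Y x} = 1 / r"
    using standard_pareto_tail assms by blast
  have pos: "emeasure M {x \<in> space M. r \<le> Y x} \<noteq> 0"
    using assms(4) by (auto simp: emeasure_eq_measure)
  interpret U: prob_space ?U
    using pos by (intro prob_space_uniform_measure) (auto simp: emeasure_eq_measure)
  interpret PY: prob_space "distr M borel Y" by (rule prob_space_distr) simp
  interpret PV: prob_space "distr M N V" by (rule prob_space_distr) simp
  show "sigma_finite_measure (distr M borel Y)" "sigma_finite_measure (distr M N V)" ..
  fix A B assume "A \<in> sets (distr M borel Y)" "B \<in> sets (distr M N V)"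
  then have [measurable]: "A \<in> sets borel" "B \<in> sets N" by auto
  let ?R = "{x \<in> space M. r \<le> Y x}"
  have "{y. r \<le> y \<and> y / r \<in> A} \<in> sets borel" by measurable
  from indep_setD[OF indep in_vimage_algebra[OF this] in_vimage_algebra[OF \<open>B \<in> sets N\<close>]]
  have split: "prob (?R \<inter> {x \<in> space M. Y x / r \<in> A \<and> V x \<in> B}) =
      prob (?R \<inter> {x \<in> space M. Y x / r \<in> A}) * prob {x \<in> space M. V x \<in> B}"
    by (simp add: vimage_def Int_def conj_ac)
  have "measure ?U {x \<in> space M. Y x / r \<in> A \<and> V x \<in> B} =
      measure ?U {x \<in> space M. Y x / r \<in> A} * prob {x \<in> space M. V x \<in> B}"
    using pos split by (simp add: measure_uniform_measure emeasure_eq_measure)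
  also have "measure ?U {x \<in> space M. Y x / r \<in> A} =
      measure (distr ?U borel (\<lambda>x. Y x / r)) A"
    by (simp add: measure_distr vimage_Int_eq_Collect)
  also have "\<dots> = measure (distr M borel Y) A"
    using standard_pareto_rescaled[OF assms(1,2,4)] by simp
  finally show "emeasure (distr M borel Y) A * emeasure (distr M N V) B =
      emeasure (distr ?U (borel \<Otimes>\<^sub>M N) (\<lambda>x. (Y x / r, V x))) (A \<times> B)"
    by (simp add: emeasure_distr U.emeasure_eq_measure PY.emeasure_eq_measure emeasure_eq_measure
        vimage_Int_eq_Collect flip: ennreal_mult)
qed simp

text \<open>
  The preceding law does not depend on the level \<open>r\<close>; comparing level \<open>r\<close> with level 1, where the
  conditioning event has probability one, gives the homogeneity of order \<open>-1\<close>.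
\<close>

lemma standard_pareto_scaling:
  assumes "prob_space M" "standard_pareto M Y" "V \<in> M \<rightarrow>\<^sub>M N" "r \<ge> 1"
    and indep: "prob_space.indep_set M (sets (vimage_algebra (space M) Y borel))
      (sets (vimage_algebra (space M) V N))"
    and G: "G \<in> sets (borel \<Otimes>\<^sub>M N)"
  shows "measure M {x \<in> space M. r \<le> Y x \<and> (Y x / r, V x) \<in> G} =
    1 / r * measure M {x \<in> space M. (Y x, V x) \<in> G}"
proof -
  interpret prob_space M by fact
  note [measurable] = assms(3) G
  have [measurable]: "Y \<in> borel_measurable M"
    using assms by (simp add: standard_pareto_def)
  have tail: "measure M {x \<in> space M. c \<le> Y x} = 1 / c" if "c \<ge> 1" for c
    using standard_pareto_tail(2)[OF assms(1,2) that] .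
  have law: "measure (distr M borel Y \<Otimes>\<^sub>M distr M N V) G =
      c * measure M {x \<in> space M. c \<le> Y x \<and> (Y x / c, V x) \<in> G}" if c: "c \<ge> 1" for c
  proof -
    have "measure (distr M borel Y \<Otimes>\<^sub>M distr M N V) G =
      measure (uniform_measure M {x \<in> space M. c \<le> Y x}) {x \<in> space M. (Y x / c, V x) \<in> G}"
      unfolding standard_pareto_rescaled_pair[OF assms(1-3) c indep, symmetric]
      by (simp add: measure_distr vimage_Int_eq_Collect)
    also have "\<dots> = measure M ({x \<in> space M. c \<le> Y x} \<inter> {x \<in> space M. (Y x / c, V x) \<in> G}) / (1 / c)"
      using c tail[OF c] by (subst measure_uniform_measure) (auto simp: emeasure_eq_measure)
    also have "{x \<in> space M. c \<le> Y x} \<inter> {x \<in> space M. (Y x / c, V x) \<in> G} =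
        {x \<in> space M. c \<le> Y x \<and> (Y x / c, V x) \<in> G}" by auto
    finally show ?thesis by simp
  qed
  have "AE x in M. 1 \<le> Y x"
    using standard_pareto_AE_gt_1[OF assms(1,2)] by eventually_elim simp
  then have "measure M {x \<in> space M. 1 \<le> Y x \<and> (Y x / 1, V x) \<in> G} =
      measure M {x \<in> space M. (Y x, V x) \<in> G}"
    by (intro finite_measure_eq_AE) auto
  with law[of 1] law[OF assms(4)] assms(4) show ?thesis by (simp add: field_simps)
qed

text \<open>
  The half-lines starting above 1 alone do not generate the Borel sets of the real line. The remaining
  ones are harmless, because \<open>Y\<close> exceeds them almost surely and events of probability one are
  independent of everything.
\<close>

lemma independent_of_process_from_tails:
  assumes "prob_space M" "standard_pareto M Y" and V: "V \<in> M \<rightarrow>\<^sub>M Pi\<^sub>M S (\<lambda>_. borel)"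
    and prod: "\<And>t E. t > 1 \<Longrightarrow> E \<in> sets (Pi\<^sub>M S (\<lambda>_. borel)) \<Longrightarrow>
      measure M {x \<in> space M. Y x > t \<and> V x \<in> E} =
      measure M {x \<in> space M. Y x > t} * measure M {x \<in> space M. V x \<in> E}"
  shows "independent_of_process M S Y V"
proof -
  interpret prob_space M by fact
  note [measurable] = V
  have [measurable]: "Y \<in> borel_measurable M"
    using assms by (simp add: standard_pareto_def)
  let ?A = "{Y -` A \<inter> space M |A. A \<in> range (\<lambda>t::real. {t<..})}"
  let ?B = "{V -` E \<inter> space M |E. E \<in> sets (Pi\<^sub>M S (\<lambda>_. borel))}"
  have "indep_set (sigma_sets (space M) ?A) (sigma_sets (space M) ?B)"
  proof (intro indep_set_sigma_sets indep_setI)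
    show "?A \<subseteq> events" "?B \<subseteq> events" by (auto intro: measurable_sets)
    show "Int_stable ?A"
    proof (rule Int_stableI)
      fix a b assume "a \<in> ?A" "b \<in> ?A"
      then obtain s t where "a = Y -` {s<..} \<inter> space M" "b = Y -` {t<..} \<inter> space M" by blast
      then have "a \<inter> b = Y -` {max s t<..} \<inter> space M" by auto
      then show "a \<inter> b \<in> ?A" by blast
    qed
    show "Int_stable ?B"
    proof (rule Int_stableI)
      fix a b assume "a \<in> ?B" "b \<in> ?B"
      then obtain E F where "a = V -` E \<inter> space M" "b = V -` F \<inter> space M"
        and EF: "E \<in> sets (Pi\<^sub>M S (\<lambda>_. borel))" "F \<in> sets (Pi\<^sub>M S (\<lambda>_. borel))" by blast
      then have "a \<inter> b = V -` (E \<inter> F) \<inter> space M" by auto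
      then show "a \<inter> b \<in> ?B" using sets.Int[OF EF] by blast
    qed
    fix a b assume "a \<in> ?A" "b \<in> ?B"
    then obtain t E where a: "a = {x \<in> space M. Y x > t}" and b: "b = {x \<in> space M. V x \<in> E}"
      and E[measurable]: "E \<in> sets (Pi\<^sub>M S (\<lambda>_. borel))"
      by auto
    have ab: "a \<inter> b = {x \<in> space M. Y x > t \<and> V x \<in> E}" by (auto simp: a b)
    show "prob (a \<inter> b) = prob a * prob b"
    proof (cases "t > 1")
      case True
      then show ?thesis using prod[OF True E] by (simp only: ab) (simp add: a b)
    next
      case False
      have "AE x in M. t < Y x"
        using standard_pareto_AE_gt_1[OF assms(1,2)] by eventually_elim (use False in simp)
      then have "prob a = 1" "prob (a \<inter> b) = prob b"
        unfolding ab unfolding a b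
        by (auto simp: prob_Collect_eq_1 intro!: finite_measure_eq_AE)
      then show ?thesis by simp
    qed
  qed
  moreover have "sets (vimage_algebra (space M) Y borel) = sigma_sets (space M) ?A"
    unfolding borel_Ioi by (subst vimage_algebra_sigma; (subst sets_measure_of)?) auto
  moreover have "sets (vimage_algebra (space M) V (Pi\<^sub>M S (\<lambda>_. borel))) = sigma_sets (space M) ?B"
    by (simp add: sets_vimage_algebra)
  ultimately show ?thesis by (simp add: independent_of_process_def)
qed

section \<open>The cycle of implications\<close>

text \<open>
  Every path of \<open>W\<close> is the image of the pair \<open>(Y, V)\<close> under multiplication, so up to null sets
  \<open>W \<in> A\<close> and \<open>W \<in> rA\<close> become the events of \<open>standard_pareto_scaling\<close> for the preimage \<open>G\<close> of \<open>A\<close>.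
\<close>

lemma constructive_imp_pareto_random_function:
  fixes S :: "'a::{metric_space, second_countable_topology} set"
  assumes M: "prob_space M" and S: "compact S" "S \<noteq> {}" and W: "C_plus_process M S W"
    and \<omega>: "\<omega> > 0" and rep: "constructive_representation M \<omega> S W"
  shows "pareto_random_function M \<omega> S W"
proof -
  interpret prob_space M by fact
  obtain Y V where WYV: "\<And>x s. x \<in> space M \<Longrightarrow> s \<in> S \<Longrightarrow> W x s = Y x * V x s"
    and V: "C_plus_process M S V" and supV: "AE x in M. (SUP s\<in>S. V x s) = \<omega>"
    and EV: "\<And>s. s \<in> S \<Longrightarrow> integral\<^sup>L M (\<lambda>x. V x s) > 0"
    and Y: "standard_pareto M Y" and ind: "independent_of_process M S Y V"
    using rep unfolding constructive_representation_def by blast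
  let ?P = "Pi\<^sub>M S (\<lambda>_. borel) :: ('a \<Rightarrow> real) measure"
  have [measurable]: "Y \<in> borel_measurable M" using Y by (simp add: standard_pareto_def)
  have Wm[measurable]: "W \<in> M \<rightarrow>\<^sub>M path_space S" and Vm: "V \<in> M \<rightarrow>\<^sub>M path_space S"
    using W V C_plus_process_iff_measurable[OF S(1)] by auto
  have [measurable]: "(\<lambda>f. SUP s\<in>S. f s) \<in> borel_measurable (path_space S)"
    by (rule measurable_path_SUP[OF S])
  have VP[measurable]: "V \<in> M \<rightarrow>\<^sub>M ?P"
    using Vm measurable_restrict_space2_iff by blast
  have Wx: "W x \<in> C_plus S" and Vx: "V x \<in> C_plus S" if "x \<in> space M" for x
    using W V that by (auto simp: C_plus_process_def)
  have Y1: "AE x in M. 1 < Y x"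
    by (rule standard_pareto_AE_gt_1[OF M Y])
  have scale: "scale_fun S c (W x) = (\<lambda>s\<in>S. (Y x * c) * V x s)" if "x \<in> space M" for x c
    using WYV[OF that] by (auto simp: scale_fun_def)
  have Wscale: "W x = (\<lambda>s\<in>S. Y x * V x s)" if "x \<in> space M" for x
    using WYV[OF that] Wx[OF that] by (auto simp: C_plus_iff[OF S(1)] extensional_def fun_eq_iff)
  have supW: "AE x in M. (SUP s\<in>S. W x s) = Y x * \<omega>"
    using Y1 supV AE_space
  proof eventually_elim
    case (elim x)
    then have "(SUP s\<in>S. W x s) = (SUP s\<in>S. Y x * V x s)" using WYV by (intro SUP_cong) auto
    also have "\<dots> = Y x * (SUP s\<in>S. V x s)"
      using elim Vx[of x] by (intro SUP_mult_left_nonneg S) (auto simp: C_plus_iff[OF S(1)])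
    finally show ?case using elim by simp
  qed
  have "AE x in M. (SUP s\<in>S. W x s) > \<omega>"
    using supW Y1 by eventually_elim (use \<omega> in auto)
  then have a: "prob {x \<in> space M. (SUP s\<in>S. W x s) > \<omega>} = 1"
    by (subst prob_Collect_eq_1) auto
  have b: "integral\<^sup>L M (\<lambda>x. W x s / (SUP u\<in>S. W x u)) > 0" if s: "s \<in> S" for s
  proof -
    have [measurable]: "(\<lambda>x. W x s) \<in> borel_measurable M" "(\<lambda>x. V x s) \<in> borel_measurable M"
      using W V s by (auto simp: C_plus_process_def)
    have "AE x in M. W x s / (SUP u\<in>S. W x u) = V x s / \<omega>"
      using supW Y1 AE_space by eventually_elim (use \<omega> s WYV in auto)
    then have "integral\<^sup>L M (\<lambda>x. W x s / (SUP u\<in>S. W x u)) = integral\<^sup>L M (\<lambda>x. V x s / \<omega>)"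
      by (intro integral_cong_AE) auto
    then show ?thesis using EV[OF s] \<omega> by simp
  qed
  have c: "prob {x \<in> space M. W x \<in> scale_set S r A} = 1 / r * prob {x \<in> space M. W x \<in> A}"
    if r: "r > 1" and A: "A \<in> borel_subsets (submetric (C_space S) (C_plus_ge \<omega> S))" for r A
  proof -
    have Am[measurable]: "A \<in> sets (path_space S)" and A_ge: "A \<subseteq> C_plus_ge \<omega> S"
      using A borel_subsets_iff_sets_path_space[OF S sets_C_plus_ge_C_plus_eq(1)[OF S]] by blast+
    obtain E where E[measurable]: "E \<in> sets ?P" and AE: "A = E \<inter> C_plus S"
      using Am by (auto simp: sets_restrict_space)
    let ?\<Phi> = "\<lambda>(y, v). \<lambda>s\<in>S. y * v s"
    have \<Phi>[measurable]: "?\<Phi> \<in> borel \<Otimes>\<^sub>M ?P \<rightarrow>\<^sub>M ?P"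
      unfolding case_prod_beta by (rule measurable_restrict) measurable
    define G where "G = ?\<Phi> -` E \<inter> space (borel \<Otimes>\<^sub>M ?P)"
    have G[measurable]: "G \<in> sets (borel \<Otimes>\<^sub>M ?P)"
      unfolding G_def by (rule measurable_sets[OF \<Phi> E])
    have inG: "(y, V x) \<in> G \<longleftrightarrow> (\<lambda>s\<in>S. y * V x s) \<in> E" if "x \<in> space M" for x y
      using measurable_space[OF VP that] by (simp add: G_def space_pair_measure)
    have "(W x \<in> A) = ((Y x, V x) \<in> G)" if x: "x \<in> space M" for x
      using inG[OF x, of "Y x"] Wscale[OF x] Wx[OF x] by (simp add: AE)
    then have 1: "{x \<in> space M. (Y x, V x) \<in> G} = {x \<in> space M. W x \<in> A}"
      by blast
    have inA: "W x \<in> scale_set S r A \<longleftrightarrow> scale_fun S (1 / r) (W x) \<in> A" if "x \<in> space M" for x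
      using r Wx[OF that] AE by (intro in_scale_set_iff) (auto simp: C_plus_iff[OF S(1)])
    have "AE x in M. (W x \<in> scale_set S r A) = (r \<le> Y x \<and> (Y x / r, V x) \<in> G)"
      using supW AE_space
    proof eventually_elim
      case (elim x)
      have in_C: "scale_fun S (1 / r) (W x) \<in> C_plus S"
        using scale_fun_in_C_plus[OF S(1) _ Wx] r elim by simp
      have "W x \<in> scale_set S r A \<longleftrightarrow> (Y x / r, V x) \<in> G"
        using inA[of x] inG[of x "Y x / r"] scale[of x "1 / r"] in_C elim by (simp add: AE)
      \<comment> \<open>Members of \<open>A\<close> have supremum at least \<open>\<omega>\<close>, those of \<open>rA\<close> at least \<open>r\<omega>\<close>, and \<open>V\<close>
        contributes only the factor \<open>\<omega>\<close>.\<close>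
      moreover have "r \<le> Y x" if "W x \<in> scale_set S r A"
      proof -
        have "\<omega> \<le> (SUP s\<in>S. scale_fun S (1 / r) (W x) s)"
          using that inA[of x] A_ge elim by (auto simp: C_plus_ge_def)
        also have "\<dots> = Y x * \<omega> / r"
          using SUP_scale_fun[OF S _ Wx, of "1 / r" x] elim r by simp
        finally show ?thesis using r \<omega> by (simp add: field_simps)
      qed
      ultimately show ?case by blast
    qed
    moreover have "{x \<in> space M. W x \<in> scale_set S r A} = {x \<in> space M. scale_fun S (1 / r) (W x) \<in> A}"
      using inA by blast
    then have "{x \<in> space M. W x \<in> scale_set S r A} \<in> events"
      using measurable_scale_fun[OF S(1), of "1 / r"] r by simp
    ultimately have 2: "prob {x \<in> space M. W x \<in> scale_set S r A} =
        prob {x \<in> space M. r \<le> Y x \<and> (Y x / r, V x) \<in> G}"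
      by (intro finite_measure_eq_AE) auto
    show ?thesis
      unfolding 2 1[symmetric]
      using standard_pareto_scaling[OF M Y VP _ ind[unfolded independent_of_process_def] G, of r] r by simp
  qed
  show ?thesis
    unfolding pareto_random_function_def using a b c by blast
qed

text \<open>
  Homogeneity yields the joint law of supremum and shape above all thresholds \<open>r\<omega>\<close> in one formula
  (\<open>tail\<close> below). Both the Pareto tail of the supremum and the conditional law of the shape are read
  off from it.
\<close>

lemma pareto_random_function_imp_peaks:
  fixes S :: "'a::{metric_space, second_countable_topology} set"
  assumes M: "prob_space M" and S: "compact S" "S \<noteq> {}" and W: "C_plus_process M S W"
    and \<omega>: "\<omega> > 0" and pareto: "pareto_random_function M \<omega> S W"
  shows "peaks_over_threshold M \<omega> S W"
proof -
  interpret prob_space M by fact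
  have a: "prob {x \<in> space M. (SUP s\<in>S. W x s) > \<omega>} = 1"
    and c: "\<And>r A. r > 1 \<Longrightarrow> A \<in> borel_subsets (submetric (C_space S) (C_plus_ge \<omega> S)) \<Longrightarrow>
        prob {x \<in> space M. W x \<in> scale_set S r A} = 1 / r * prob {x \<in> space M. W x \<in> A}"
    using pareto by (auto simp: pareto_random_function_def)
  let ?N = "normalized_path \<omega> S"
  have [measurable]: "W \<in> M \<rightarrow>\<^sub>M path_space S"
    using W C_plus_process_iff_measurable[OF S(1)] by auto
  have [measurable]: "(\<lambda>f. SUP s\<in>S. f s) \<in> borel_measurable (path_space S)"
    by (rule measurable_path_SUP[OF S])
  have N[measurable]: "?N \<in> path_space S \<rightarrow>\<^sub>M path_space S"
    using measurable_normalized_path[OF S, of \<omega>] \<omega> by simp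
  have Wx: "W x \<in> C_plus S" if "x \<in> space M" for x
    using W that by (auto simp: C_plus_process_def)
  have sup: "AE x in M. (SUP s\<in>S. W x s) > \<omega>"
    using a by (subst (asm) prob_Collect_eq_1) auto
  have tail: "prob {x \<in> space M. ?N (W x) \<in> E \<and> (SUP s\<in>S. W x s) > r * \<omega>} =
      1 / r * prob {x \<in> space M. ?N (W x) \<in> E}"
    if r: "r > 1" and [measurable]: "E \<in> sets (path_space S)" for r E
  proof -
    \<comment> \<open>The strict inequality makes the dilate of this set match the event that the supremum exceeds
      \<open>r\<omega>\<close>. It costs no probability, as the supremum exceeds \<open>\<omega>\<close> almost surely.\<close>
    define A where "A = {f \<in> space (path_space S). (SUP s\<in>S. f s) > \<omega> \<and> ?N f \<in> E}"
    have Am[measurable]: "A \<in> sets (path_space S)" unfolding A_def by measurable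
    have A: "A \<in> borel_subsets (submetric (C_space S) (C_plus_ge \<omega> S))"
      unfolding borel_subsets_iff_sets_path_space[OF S sets_C_plus_ge_C_plus_eq(1)[OF S]]
      using Am by (auto simp: A_def C_plus_ge_def space_path_space[OF S(1)])
    have "W x \<in> scale_set S r A \<longleftrightarrow> ?N (W x) \<in> E \<and> (SUP s\<in>S. W x s) > r * \<omega>"
      if x: "x \<in> space M" for x
    proof -
      have "W x \<in> scale_set S r A \<longleftrightarrow> scale_fun S (1 / r) (W x) \<in> A"
        using r Wx[OF x]
        by (intro in_scale_set_iff) (auto simp: A_def space_path_space[OF S(1)] C_plus_iff[OF S(1)])
      also have "\<dots> \<longleftrightarrow> 1 / r * (SUP s\<in>S. W x s) > \<omega> \<and> ?N (W x) \<in> E"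
        using r SUP_scale_fun[OF S _ Wx[OF x], of "1 / r"] scale_fun_in_C_plus[OF S(1) _ Wx[OF x], of "1 / r"]
          normalized_path_scale_fun[OF S _ Wx[OF x], of "1 / r" \<omega>]
        by (simp add: A_def space_path_space[OF S(1)])
      also have "1 / r * (SUP s\<in>S. W x s) > \<omega> \<longleftrightarrow> (SUP s\<in>S. W x s) > r * \<omega>"
        using r by (simp add: field_simps)
      finally show ?thesis by blast
    qed
    then have "{x \<in> space M. ?N (W x) \<in> E \<and> (SUP s\<in>S. W x s) > r * \<omega>} =
        {x \<in> space M. W x \<in> scale_set S r A}" by blast
    moreover have "prob {x \<in> space M. W x \<in> A} = prob {x \<in> space M. ?N (W x) \<in> E}"
    proof (rule finite_measure_eq_AE)
      show "AE x in M. (x \<in> {x \<in> space M. W x \<in> A}) = (x \<in> {x \<in> space M. ?N (W x) \<in> E})"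
        using sup AE_space
        by eventually_elim (use Wx in \<open>simp add: A_def space_path_space[OF S(1)]\<close>)
    qed measurable
    ultimately show ?thesis using c[OF r A] by simp
  qed
  have N_space: "?N (W x) \<in> space (path_space S)" if "x \<in> space M" for x
    using measurable_space[OF N] Wx[OF that] by (simp add: space_path_space[OF S(1)])
  have sup_tail: "prob {x \<in> space M. (SUP s\<in>S. W x s) > r * \<omega>} = 1 / r" if "r > 1" for r
  proof -
    have "{x \<in> space M. ?N (W x) \<in> space (path_space S) \<and> (SUP s\<in>S. W x s) > r * \<omega>} =
        {x \<in> space M. (SUP s\<in>S. W x s) > r * \<omega>}"
      "{x \<in> space M. ?N (W x) \<in> space (path_space S)} = space M"
      using N_space by auto
    then show ?thesis using tail[OF that, of "space (path_space S)"] by (simp add: prob_space)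
  qed
  have cond: "\<P>(x in M. ?N (W x) \<in> B \<bar> (SUP s\<in>S. W x s) > r) = prob {x \<in> space M. ?N (W x) \<in> B}"
    if r: "r > \<omega>" and B: "B \<in> borel_subsets (submetric (C_space S) (C_plus_eq \<omega> S))" for r B
  proof -
    have B': "B \<in> sets (path_space S)"
      using B borel_subsets_iff_sets_path_space[OF S sets_C_plus_ge_C_plus_eq(2)[OF S]] by blast
    have r': "r / \<omega> > 1" "r / \<omega> * \<omega> = r" using r \<omega> by auto
    show ?thesis
      unfolding cond_prob_def using tail[OF r'(1) B'] sup_tail[OF r'(1)] r' \<omega> by simp
  qed
  have "\<P>(x in M. (SUP s\<in>S. W x s) / \<omega> > t) = 1 / t" if "t > 1" for t
    using sup_tail[OF that] \<omega> by (simp add: pos_less_divide_eq)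
  then show ?thesis
    using pareto cond unfolding peaks_over_threshold_def pareto_random_function_def by blast
qed

text \<open>
  The factorisation \<open>W = YV\<close> holds for every outcome: where the supremum is zero, the nonnegative path
  vanishes, and so do the quotients that define \<open>V\<close>.
\<close>

lemma peaks_imp_constructive:
  fixes S :: "'a::{metric_space, second_countable_topology} set"
  assumes M: "prob_space M" and S: "compact S" "S \<noteq> {}" and W: "C_plus_process M S W"
    and \<omega>: "\<omega> > 0" and peaks: "peaks_over_threshold M \<omega> S W"
  shows "constructive_representation M \<omega> S W"
  unfolding constructive_representation_def
proof (intro exI conjI ballI)
  interpret prob_space M by fact
  let ?Y = "\<lambda>x. (SUP s\<in>S. W x s) / \<omega>" and ?V = "\<lambda>x. normalized_path \<omega> S (W x)"
  let ?P = "Pi\<^sub>M S (\<lambda>_. borel) :: ('a \<Rightarrow> real) measure"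
  have Wm[measurable]: "W \<in> M \<rightarrow>\<^sub>M path_space S"
    using W C_plus_process_iff_measurable[OF S(1)] by auto
  have [measurable]: "(\<lambda>f. SUP s\<in>S. f s) \<in> borel_measurable (path_space S)"
    by (rule measurable_path_SUP[OF S])
  have Vm: "?V \<in> M \<rightarrow>\<^sub>M path_space S"
    using measurable_compose[OF Wm measurable_normalized_path[OF S]] \<omega> by simp
  then show V: "C_plus_process M S ?V"
    using C_plus_process_iff_measurable[OF S(1)] by blast
  have VP[measurable]: "?V \<in> M \<rightarrow>\<^sub>M ?P"
    using Vm measurable_restrict_space2_iff by blast
  have Wx: "W x \<in> C_plus S" if "x \<in> space M" for x
    using W that by (auto simp: C_plus_process_def)
  show "W x s = ?Y x * ?V x s" if "x \<in> space M" "s \<in> S" for x s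
  proof (cases "(SUP s\<in>S. W x s) = 0")
    case True
    have "continuous_on S (W x)" "0 \<le> W x s" using Wx that by (auto simp: C_plus_iff[OF S(1)])
    then have "W x s = 0" using SUP_attained[OF S, of "W x"] True that(2) by (metis order_antisym)
    then show ?thesis using True by simp
  next
    case False
    then show ?thesis using that \<omega> by (simp add: normalized_path_def)
  qed
  have tail: "prob {x \<in> space M. ?Y x > t} = 1 / t" if "t > 1" for t
    using peaks that by (simp add: peaks_over_threshold_def)
  show Y: "standard_pareto M ?Y"
    unfolding standard_pareto_def
  proof (intro conjI allI impI)
    fix y :: real assume "y > 1"
    then show "prob {x \<in> space M. ?Y x \<le> y} = 1 - 1 / y"
      using prob_neg[of "\<lambda>x. ?Y x > y"] tail[of y] by (simp add: not_less)
  qed measurable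
  have "AE x in M. 1 < ?Y x"
    by (rule standard_pareto_AE_gt_1[OF M Y])
  then have sup: "AE x in M. (SUP s\<in>S. W x s) > 0"
    by eventually_elim (use \<omega> in \<open>auto simp: field_simps\<close>)
  then show "AE x in M. (SUP s\<in>S. ?V x s) = \<omega>"
    using AE_space by eventually_elim (use SUP_normalized_path[OF S _ Wx] \<omega> in auto)
  show "integral\<^sup>L M (\<lambda>x. ?V x s) > 0" if "s \<in> S" for s
  proof -
    have "integral\<^sup>L M (\<lambda>x. ?V x s) = \<omega> * integral\<^sup>L M (\<lambda>x. W x s / (SUP u\<in>S. W x u))"
      using that by (simp add: normalized_path_def flip: integral_mult_right_zero)
    then show ?thesis
      using peaks that \<omega> by (simp add: peaks_over_threshold_def)
  qed
  show "independent_of_process M S ?Y ?V"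
  proof (rule independent_of_process_from_tails[OF M Y VP])
    fix t :: real and E assume t: "t > 1" and E[measurable]: "E \<in> sets ?P"
    \<comment> \<open>The hypothesis speaks only of Borel sets of paths with supremum \<open>\<omega>\<close>, while \<open>E\<close> is an
      arbitrary set of the product; almost surely \<open>?V\<close> does not see the difference.\<close>
    define B where "B = E \<inter> C_plus_eq \<omega> S"
    have eq: "C_plus_eq \<omega> S \<in> sets (path_space S)"
      by (rule sets_C_plus_ge_C_plus_eq[OF S])
    have "B = (E \<inter> C_plus S) \<inter> C_plus_eq \<omega> S"
      by (auto simp: B_def C_plus_eq_def)
    moreover have "E \<inter> C_plus S \<in> sets (path_space S)"
      using E unfolding sets_restrict_space by blast
    ultimately have Bm[measurable]: "B \<in> sets (path_space S)"
      using eq by simp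
    then have B: "B \<in> borel_subsets (submetric (C_space S) (C_plus_eq \<omega> S))"
      unfolding borel_subsets_iff_sets_path_space[OF S eq] by (simp add: B_def)
    have N_iff: "?V x \<in> B \<longleftrightarrow> ?V x \<in> E" if "x \<in> space M" "(SUP s\<in>S. W x s) > 0" for x
      using normalized_path_in_C_plus_eq[OF S _ Wx[OF that(1)], of \<omega>] that \<omega> by (simp add: B_def)
    have r: "t * \<omega> > \<omega>" using t \<omega> by simp
    have Y_iff: "?Y x > t \<longleftrightarrow> (SUP s\<in>S. W x s) > t * \<omega>" for x
      using \<omega> by (simp add: pos_less_divide_eq)
    have 1: "prob {x \<in> space M. ?V x \<in> B} = prob {x \<in> space M. ?V x \<in> E}"
    proof (rule finite_measure_eq_AE)
      show "AE x in M. (x \<in> {x \<in> space M. ?V x \<in> B}) = (x \<in> {x \<in> space M. ?V x \<in> E})"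
        using sup AE_space by eventually_elim (use N_iff in blast)
      show "{x \<in> space M. ?V x \<in> B} \<in> events" "{x \<in> space M. ?V x \<in> E} \<in> events"
        using Vm by measurable
    qed
    have pos: "(SUP s\<in>S. W x s) > 0" if "(SUP s\<in>S. W x s) > t * \<omega>" for x
      using that r \<omega> by linarith
    have 2: "{x \<in> space M. ?V x \<in> B \<and> (SUP s\<in>S. W x s) > t * \<omega>} = {x \<in> space M. ?Y x > t \<and> ?V x \<in> E}"
      unfolding Y_iff using N_iff pos by blast
    have "\<P>(x in M. ?V x \<in> B \<bar> (SUP s\<in>S. W x s) > t * \<omega>) = prob {x \<in> space M. ?V x \<in> B}"
      using peaks r B unfolding peaks_over_threshold_def by blast
    then have "prob {x \<in> space M. ?Y x > t \<and> ?V x \<in> E} / prob {x \<in> space M. ?Y x > t} =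
        prob {x \<in> space M. ?V x \<in> E}"
      unfolding cond_prob_def 1 2 Y_iff .
    then show "prob {x \<in> space M. ?Y x > t \<and> ?V x \<in> E} =
        prob {x \<in> space M. ?Y x > t} * prob {x \<in> space M. ?V x \<in> E}"
      using t unfolding tail[OF t] by (simp add: field_simps)
  qed
qed

theorem theorem2p1:
  fixes M :: "'w measure"
    and S :: "(real ^ 'd) set"
    and W :: "'w \<Rightarrow> real ^ 'd \<Rightarrow> real"
    and \<omega>\<^sub>0 :: real
  assumes "prob_space M"
    and "compact S" and "S \<noteq> {}"
    and "C_plus_process M S W"
    and "\<omega>\<^sub>0 > 0"
  shows "(peaks_over_threshold M \<omega>\<^sub>0 S W \<longleftrightarrow> pareto_random_function M \<omega>\<^sub>0 S W) \<and>
         (pareto_random_function M \<omega>\<^sub>0 S W \<longleftrightarrow> constructive_representation M \<omega>\<^sub>0 S W)"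
proof -
  have "constructive_representation M \<omega>\<^sub>0 S W" if "peaks_over_threshold M \<omega>\<^sub>0 S W"
    using peaks_imp_constructive[OF assms that] .
  moreover have "pareto_random_function M \<omega>\<^sub>0 S W" if "constructive_representation M \<omega>\<^sub>0 S W"
    using constructive_imp_pareto_random_function[OF assms that] .
  moreover have "peaks_over_threshold M \<omega>\<^sub>0 S W" if "pareto_random_function M \<omega>\<^sub>0 S W"
    using pareto_random_function_imp_peaks[OF assms that] .
  ultimately show ?thesis by blast
qed

end
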